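(* Let $\mathbb P,\mathbb X,\mathbb Y$ be real Banach spaces, let $C$ be a closed convex cone with $\{\mathbf 0\}\subsetneqq C\subsetneqq\mathbb Y$, let $\varphi:\mathbb P\times\mathbb X\to\mathbb R$, and let $F:\mathbb P\times\mathbb X\rightrightarrows\mathbb Y$ be a set-valued mapping with nonempty closed values. For $p\in\mathbb P$ let $(\mathsf P_p)$ be the problem of minimizing $\varphi(p,x)$ over $x\in\mathbb X$ subject to $F(p,x)\subseteq C$, and put $\mathsf R(p)=\{x\in\mathbb X\mid F(p,x)\subseteq C\}$, $\mathsf{val}(p)=\inf_{x\in\mathsf R(p)}\varphi(p,x)$, $\mathsf{Argmin}(p)=\{x\in\mathsf R(p)\mid\varphi(p,x)=\mathsf{val}(p)\}$. Suppose that the family $(\mathsf P_p)_{p\in\mathbb P}$ is q.c.s.v.i. (defined in the context), with $\mathrm{dom}\,\mathsf{val}=\mathbb P$, and that for any $\bar p\in\mathrm{dom}\,\mathsf{val}=\mathbb P$ and any $\bar x\in\mathsf{Argmin}(\bar p)$ there exist positive $\beta$ and $r_\beta$ such that $$\mathrm{dist}\bigl(\bar p;\{p\in\mathbb P\mid F(p,x)\subseteq C\}\bigr)\le\beta\,\mathrm{exc}(F(\bar p,x);C),\quad\forall x\in\mathrm B[\bar x;r_\beta].$$ Then, for any $\bar p\in\mathbb P$, problem $(\mathsf P_{\bar p})$ admits a penalty function at any $\bar x\in\mathsf{Argmin}(\bar p)$.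
   Context: Conventions: $\inf\varnothing=+\infty$, so the distance to the empty set is $+\infty$; $\mathrm{dom}\,\mathsf{val}$ is the set of points where $\mathsf{val}$ is finite. $\mathrm{dist}(y;S)=\inf_{s\in S}\|y-s\|$; $\mathrm{exc}(A;B)=\sup_{a\in A}\mathrm{dist}(a;B)$. For a nonempty set $S$ and $r\ge0$, $\mathrm B[S;r]=\{y\mid\mathrm{dist}(y;S)\le r\}$; for a point $x$, $\mathrm B[x;r]$ is the closed ball. Penalty function: $(\mathsf P_{\bar p})$ admits a penalty function at a local solution $\bar x$ if there exists $\lambda_*\ge0$ such that for every $\lambda\in(\lambda_*,+\infty)$ the point $\bar x$ is an unconstrained local minimizer of $x\mapsto\varphi(\bar p,x)+\lambda\,\mathrm{exc}(F(\bar p,x);C)$ on $\mathbb X$. q.c.s.v.i. (qualified convex with set-valued inclusion constraints) family: the family given by $(\varphi,F,C)$ is q.c.s.v.i. if (i) $\varphi$ is convex and continuous on $\mathbb P\times\mathbb X$; (ii) for every $p\in\mathbb P$ there is $\hat x_p\in\mathbb X$ such that $F(p,\hat x_p)$ is $C$-bounded, i.e. $F(p,\hat x_p)\setminus C$ is norm-bounded; (iii) for every $p$, $F(p,\cdot)$ is lower semicontinuous on $\mathbb X$; (iv) $F$ is $C$-concave: $F(t(p_1,x_1)+(1-t)(p_2,x_2))\subseteq tF(p_1,x_1)+(1-t)F(p_2,x_2)+C$ for all $(p_i,x_i)\in\mathbb P\times\mathbb X$, $t\in[0,1]$; (v) for every $x$, $F(\cdot,x)$ is Hausdorff $C$-upper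 semicontinuous on $\mathbb P$: for every $p_0\in\mathbb P$ and $\varepsilon>0$ there is $\delta>0$ with $F(p,x)\subseteq\mathrm B[F(p_0,x)+C;\varepsilon]$ for all $p\in\mathrm B[p_0;\delta]$; (vi) $\alpha_F>1$, where $\alpha_F=\inf\{\mathrm{inc}(F(p,\cdot);x)\mid(p,x)\in\mathbb P\times\mathbb X,\ F(p,x)\not\subseteq C\}$. Here, for $G:\mathbb X\rightrightarrows\mathbb Y$ and $x_0\in\mathbb X$, $\mathrm{inc}(G;x_0)$ is the supremum of all $\alpha>1$ for which there is $\delta>0$ such that for all $r\in(0,\delta]$ there exists $u\in\mathrm B[x_0;r]$ with $\mathrm B[G(u);\alpha r]\subseteq\mathrm B[G(x_0)+C;r]$ (with $\sup\varnothing=-\infty$). *)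

theory Defs
  imports "HOL-Analysis.Analysis"
begin

text \<open>
  Distances, excesses and rates are \<^typ>\<open>ereal\<close>-valued, so that infima and suprema over empty
  sets take the values \<open>\<infinity>\<close> and \<open>-\<infinity>\<close>.  The library's real-valued
  \<^const>\<open>infdist\<close> is not usable here, as it returns 0 for the empty set.  Sums of sets are the
  Minkowski sums of \<^theory>\<open>HOL-Library.Set_Algebras\<close>.
\<close>

definition point_dist :: "'a::real_normed_vector \<Rightarrow> 'a set \<Rightarrow> ereal" where
  "point_dist y S = (INF s\<in>S. ereal (norm (y - s)))"

definition exc :: "'a::real_normed_vector set \<Rightarrow> 'a set \<Rightarrow> ereal" where
  "exc A B = (SUP a\<in>A. point_dist a B)"

definition enlarge :: "'a::real_normed_vector set \<Rightarrow> real \<Rightarrow> 'a set" where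
  "enlarge S r = {y. point_dist y S \<le> ereal r}"

definition lower_semicontinuous_map :: "('a::topological_space \<Rightarrow> 'b::topological_space set) \<Rightarrow> bool"
  where
  "lower_semicontinuous_map G \<longleftrightarrow>
     (\<forall>x0 V. open V \<and> G x0 \<inter> V \<noteq> {} \<longrightarrow> (\<forall>\<^sub>F x in nhds x0. G x \<inter> V \<noteq> {}))"

definition hausdorff_C_usc ::
  "'b::real_normed_vector set \<Rightarrow> ('a::real_normed_vector \<Rightarrow> 'b set) \<Rightarrow> bool" where
  "hausdorff_C_usc C G \<longleftrightarrow>
     (\<forall>p0. \<forall>\<epsilon>>0. \<exists>\<delta>>0. \<forall>p\<in>cball p0 \<delta>. G p \<subseteq> enlarge (G p0 + C) \<epsilon>)"

definition C_bounded :: "'a::real_normed_vector set \<Rightarrow> 'a set \<Rightarrow> bool" where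
  "C_bounded C A \<longleftrightarrow> bounded (A - C)"

definition C_concave :: "'b::real_vector set \<Rightarrow> ('a::real_vector \<Rightarrow> 'b set) \<Rightarrow> bool" where
  "C_concave C F \<longleftrightarrow>
     (\<forall>z1 z2. \<forall>t\<in>{0..1}. F (t *\<^sub>R z1 + (1 - t) *\<^sub>R z2)
        \<subseteq> (\<lambda>y. t *\<^sub>R y) ` F z1 + (\<lambda>y. (1 - t) *\<^sub>R y) ` F z2 + C)"

definition inc_rate ::
  "'b::real_normed_vector set \<Rightarrow> ('a::real_normed_vector \<Rightarrow> 'b set) \<Rightarrow> 'a \<Rightarrow> ereal" where
  "inc_rate C G x0 = Sup {ereal \<alpha> | \<alpha>. \<alpha> > 1 \<and>
     (\<exists>\<delta>>0. \<forall>r\<in>{0<..\<delta>}. \<exists>u\<in>cball x0 r. enlarge (G u) (\<alpha> * r) \<subseteq> enlarge (G x0 + C) r)}"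

definition alpha_F ::
  "'y::real_normed_vector set \<Rightarrow> ('p::real_normed_vector \<times> 'x::real_normed_vector \<Rightarrow> 'y set) \<Rightarrow> ereal"
  where
  "alpha_F C F = Inf {inc_rate C (\<lambda>x'. F (p, x')) x | p x. \<not> F (p, x) \<subseteq> C}"

definition qcsvi ::
  "('p::real_normed_vector \<times> 'x::real_normed_vector \<Rightarrow> real) \<Rightarrow>
   ('p \<times> 'x \<Rightarrow> 'y::real_normed_vector set) \<Rightarrow> 'y set \<Rightarrow> bool" where
  "qcsvi \<phi> F C \<longleftrightarrow>
     convex_on UNIV \<phi> \<and> continuous_on UNIV \<phi> \<and>
     (\<forall>p. \<exists>x. C_bounded C (F (p, x))) \<and>
     (\<forall>p. lower_semicontinuous_map (\<lambda>x. F (p, x))) \<and>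
     C_concave C F \<and>
     (\<forall>x. hausdorff_C_usc C (\<lambda>p. F (p, x))) \<and>
     alpha_F C F > 1"

definition feasible :: "('p \<times> 'x \<Rightarrow> 'y set) \<Rightarrow> 'y set \<Rightarrow> 'p \<Rightarrow> 'x set" where
  "feasible F C p = {x. F (p, x) \<subseteq> C}"

definition opt_val :: "('p \<times> 'x \<Rightarrow> real) \<Rightarrow> ('p \<times> 'x \<Rightarrow> 'y set) \<Rightarrow> 'y set \<Rightarrow> 'p \<Rightarrow> ereal" where
  "opt_val \<phi> F C p = (INF x\<in>feasible F C p. ereal (\<phi> (p, x)))"

definition dom_val :: "('p \<times> 'x \<Rightarrow> real) \<Rightarrow> ('p \<times> 'x \<Rightarrow> 'y set) \<Rightarrow> 'y set \<Rightarrow> 'p set" where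
  "dom_val \<phi> F C = {p. \<bar>opt_val \<phi> F C p\<bar> \<noteq> \<infinity>}"

definition Argmin :: "('p \<times> 'x \<Rightarrow> real) \<Rightarrow> ('p \<times> 'x \<Rightarrow> 'y set) \<Rightarrow> 'y set \<Rightarrow> 'p \<Rightarrow> 'x set" where
  "Argmin \<phi> F C p = {x \<in> feasible F C p. ereal (\<phi> (p, x)) = opt_val \<phi> F C p}"

definition local_minimizer :: "('a::topological_space \<Rightarrow> ereal) \<Rightarrow> 'a \<Rightarrow> bool" where
  "local_minimizer f x0 \<longleftrightarrow> (\<forall>\<^sub>F x in nhds x0. f x0 \<le> f x)"

text \<open>
  That \<open>x0\<close> is a local solution is a presupposition of the notion rather than part of it; it
  holds for every element of \<^const>\<open>Argmin\<close>.
\<close>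

definition admits_penalty_function ::
  "('p \<times> 'x::topological_space \<Rightarrow> real) \<Rightarrow> ('p \<times> 'x \<Rightarrow> 'y::real_normed_vector set) \<Rightarrow> 'y set \<Rightarrow>
   'p \<Rightarrow> 'x \<Rightarrow> bool" where
  "admits_penalty_function \<phi> F C p x0 \<longleftrightarrow>
     (\<exists>l0\<ge>0. \<forall>l>l0.
        local_minimizer (\<lambda>x. ereal (\<phi> (p, x)) + ereal l * exc (F (p, x)) C) x0)"

end

theory Submission
  imports Defs
begin

text \<open>
  The constraint is traded for a perturbation of the parameter.  If \<open>x\<close> is close to the solution
  \<open>xbar\<close> but violates the constraint by \<open>e = exc (F (pbar, x)) C\<close>, the metric hypothesis supplies a
  parameter \<open>p\<close> within \<open>2 \<beta> e\<close> of \<open>pbar\<close> for which \<open>x\<close> is feasible, so \<open>\<phi> (p, x)\<close> is at least the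
  optimal value at \<open>p\<close>.  Two estimates linear in \<open>norm (p - pbar)\<close> then bound \<open>\<phi> (pbar, x)\<close> from
  below by \<open>\<phi> (pbar, xbar) - K * norm (p - pbar)\<close>: moving from \<open>p\<close> back to \<open>pbar\<close> costs little because
  \<open>\<phi>\<close> is convex and continuous, and the optimal value cannot drop faster than linearly.  The loss is
  at most \<open>2 \<beta> K e\<close>, which any multiplier above \<open>2 \<beta> K\<close> pays for.  When \<open>e\<close> is too large for \<open>p\<close> to
  be near \<open>pbar\<close>, the penalty term alone outweighs the variation of \<open>\<phi>\<close>.

  The substantial point is the linear lower bound on the optimal value (\<open>opt_val_calm_below\<close>).  The
  optimal value function is convex, since \<open>C\<close>-concavity of \<open>F\<close> makes the graph of the feasible set map
  convex (\<open>convex_opt_val\<close>).  A finite convex function on an infinite-dimensional space may be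
  discontinuous everywhere, but a bound from above on a single ball around \<open>pbar\<close> suffices
  (\<open>convex_lower_bound\<close>).  To obtain it, take a point \<open>x0\<close> feasible for \<open>pbar\<close>.  By upper
  semicontinuity in the parameter, \<open>x0\<close> violates the constraint only slightly for \<open>p\<close> near \<open>pbar\<close>, and
  an error bound (\<open>error_bound\<close>) moves \<open>x0\<close> by a proportionally small amount to a point feasible for
  \<open>p\<close>, where continuity controls \<open>\<phi>\<close>.

  The error bound is where the rate of increase \<open>\<alpha> > 1\<close> enters.  Enlarging the values
  of \<open>F (p, \<cdot>)\<close> at \<open>u\<close> by \<open>\<alpha> r\<close> keeps them within \<open>r\<close> of \<open>F (p, x) + C\<close>, so a step of length at most
  \<open>r\<close> decreases the excess by \<open>(\<alpha> - 1) r\<close> (\<open>exc_descent\<close>).  On a complete space a lower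
  semicontinuous function that can always be decreased at such a rate has a zero within the expected
  distance (\<open>descent_imp_zero\<close>).
\<close>

section \<open>A one-sided Lipschitz estimate for convex functions\<close>

text \<open>
  The point \<open>a\<close> lies between \<open>b\<close> and a point \<open>z\<close> on the far side of the ball.
  Since \<open>f z\<close> is at most \<open>M\<close>, a small value at \<open>b\<close> would make \<open>f a\<close> too small.
\<close>

lemma convex_lower_bound:
  fixes f :: "'a::real_normed_vector \<Rightarrow> real"
  assumes conv: "convex_on UNIV f" and "\<rho> > 0" and bound: "\<And>z. z \<in> cball a \<rho> \<Longrightarrow> f z \<le> M"
  shows "f a - (M - f a) / \<rho> * norm (b - a) \<le> f b"
proof (cases "b = a")
  case False
  define s where "s = norm (b - a)"
  have s: "s > 0" using False by (simp add: s_def)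
  define z where "z = a - (\<rho> / s) *\<^sub>R (b - a)"
  define t where "t = \<rho> / (\<rho> + s)"
  have t: "0 \<le> t" "t \<le> 1" "1 - t = s / (\<rho> + s)"
    using \<open>\<rho> > 0\<close> s by (auto simp: t_def field_simps)
  have "z \<in> cball a \<rho>"
    using \<open>\<rho> > 0\<close> s by (simp add: z_def dist_norm s_def)
  then have M: "f z \<le> M" by (rule bound)
  have "(1 - t) * (\<rho> / s) = t"
    using \<open>\<rho> > 0\<close> s by (simp add: t(3)) (simp add: t_def)
  then have "t *\<^sub>R b + (1 - t) *\<^sub>R z = a"
    unfolding z_def by (simp add: scaleR_right_diff_distrib scaleR_left_diff_distrib)
  then have "f a \<le> t * f b + (1 - t) * f z"
    using convex_onD[OF conv, of "1 - t" b z] t(1,2) by simp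
  also have "\<dots> \<le> t * f b + (1 - t) * M"
    using M t by (intro add_left_mono mult_left_mono) auto
  also have "\<dots> = (\<rho> * f b + s * M) / (\<rho> + s)"
    unfolding t(3) by (simp add: t_def add_divide_distrib)
  finally have "f a * (\<rho> + s) \<le> \<rho> * f b + s * M"
    using \<open>\<rho> > 0\<close> s by (simp add: pos_le_divide_eq)
  then show ?thesis
    using \<open>\<rho> > 0\<close> unfolding s_def[symmetric] by (simp add: field_simps)
qed simp

section \<open>Descent to a zero on a complete space\<close>

text \<open>
  A form of the principles of Ekeland and Caristi.  The set \<open>S x\<close> collects the points
  reachable from \<open>x\<close> at the prescribed rate; the relation it defines is reflexive and transitive.
  A sequence that at each step gets at least halfway down to the infimum of \<open>g\<close> over the reachable
  points is Cauchy, because each distance is paid for by a decrease of \<open>g\<close>.  Its limit is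
  reachable from every term.  A further descent from the limit would lead to a point that was
  reachable all along and yet lies below the limit of \<open>g\<close> along the sequence, which the halfway
  rule excludes.
\<close>

lemma descent_imp_zero:
  fixes g :: "'a::complete_space \<Rightarrow> real"
  assumes closed: "\<And>a. closed {x \<in> D. g x \<le> a}"
    and nonneg: "\<And>x. x \<in> D \<Longrightarrow> 0 \<le> g x"
    and "k > 0" and "x\<^sub>0 \<in> D"
    and descent: "\<And>x. x \<in> D \<Longrightarrow> 0 < g x \<Longrightarrow> \<exists>u\<in>D. u \<noteq> x \<and> g u + k * dist x u \<le> g x"
  shows "\<exists>x\<in>D. g x = 0 \<and> k * dist x\<^sub>0 x \<le> g x\<^sub>0"
proof -
  define S where "S x = {u \<in> D. g u + k * dist x u \<le> g x}" for x
  have S_refl: "x \<in> S x" if "x \<in> D" for x using that by (simp add: S_def)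
  have S_trans: "w \<in> S x" if "u \<in> S x" "w \<in> S u" for x u w
  proof -
    have "k * dist x w \<le> k * dist x u + k * dist u w"
      using dist_triangle[of x w u] \<open>k > 0\<close> by (simp flip: distrib_left)
    then show ?thesis using that by (auto simp: S_def)
  qed
  \<comment> \<open>Getting halfway to the infimum is possible even when it is not attained.\<close>
  have ex_next: "\<exists>y\<in>S x. \<forall>w\<in>S x. g y \<le> (g x + g w) / 2" if x: "x \<in> D" for x
  proof -
    let ?I = "INF w\<in>S x. g w"
    have bdd: "bdd_below (g ` S x)" using nonneg by (auto simp: S_def intro!: bdd_belowI)
    have le: "?I \<le> g w" if "w \<in> S x" for w using that bdd by (rule cINF_lower[rotated])
    show ?thesis
    proof (cases "?I = g x")
      case True
      then show ?thesis using le S_refl[OF x] by (intro bexI[of _ x]) fastforce+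
    next
      case False
      then have "?I < (g x + ?I) / 2" using le[OF S_refl[OF x]] by simp
      then obtain y where "y \<in> S x" "g y < (g x + ?I) / 2"
        using cINF_less_iff[OF _ bdd] S_refl[OF x] by blast
      then show ?thesis using le by (intro bexI[of _ y]) fastforce+
    qed
  qed
  obtain X where X: "X 0 = x\<^sub>0" "\<And>n. X n \<in> D" "\<And>n. X (Suc n) \<in> S (X n)"
    and half: "\<And>n w. w \<in> S (X n) \<Longrightarrow> g (X (Suc n)) \<le> (g (X n) + g w) / 2"
  proof -
    have "\<exists>X. \<forall>n. (X n \<in> D \<and> (n = 0 \<longrightarrow> X n = x\<^sub>0)) \<and>
        (X (Suc n) \<in> S (X n) \<and> (\<forall>w\<in>S (X n). g (X (Suc n)) \<le> (g (X n) + g w) / 2))"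
    proof (rule dependent_nat_choice)
      show "\<exists>x. x \<in> D \<and> (0 = (0::nat) \<longrightarrow> x = x\<^sub>0)" using \<open>x\<^sub>0 \<in> D\<close> by blast
    next
      fix x and n :: nat
      assume "x \<in> D \<and> (n = 0 \<longrightarrow> x = x\<^sub>0)"
      then obtain y where "y \<in> S x" "\<forall>w\<in>S x. g y \<le> (g x + g w) / 2"
        using ex_next by blast
      then show "\<exists>y. (y \<in> D \<and> (Suc n = 0 \<longrightarrow> y = x\<^sub>0)) \<and>
          (y \<in> S x \<and> (\<forall>w\<in>S x. g y \<le> (g x + g w) / 2))"
        by (auto simp: S_def)
    qed
    then show ?thesis using that by blast
  qed
  have X_S: "X m \<in> S (X n)" if "n \<le> m" for m n
    using that by (induction m rule: dec_induct) (use X S_refl S_trans in blast)+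
  have "decseq (\<lambda>n. g (X n))"
  proof (rule decseq_SucI)
    show "g (X (Suc n)) \<le> g (X n)" for n
    proof -
      have "g (X (Suc n)) + k * dist (X n) (X (Suc n)) \<le> g (X n)"
        using X(3)[of n] by (simp add: S_def)
      moreover have "0 \<le> k * dist (X n) (X (Suc n))" using \<open>k > 0\<close> by simp
      ultimately show ?thesis by linarith
    qed
  qed
  then obtain L where L: "(\<lambda>n. g (X n)) \<longlonglongrightarrow> L" "\<And>n. L \<le> g (X n)"
    using decseq_convergent[of "\<lambda>n. g (X n)" 0] nonneg[OF X(2)] by blast
  have "Cauchy X"
  proof (rule CauchyI')
    fix e :: real assume "e > 0"
    then have "eventually (\<lambda>n. g (X n) < L + k * e) sequentially"
      using L(1) \<open>k > 0\<close> by (intro order_tendstoD(2)) auto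
    then obtain N where N: "g (X N) < L + k * e" by (auto simp: eventually_sequentially)
    have decN: "g (X m) \<le> g (X N)" if "N \<le> m" for m
      using \<open>decseq (\<lambda>n. g (X n))\<close> that by (simp add: decseq_def)
    have "dist (X m) (X n) < e" if "m \<ge> N" "m < n" for m n
    proof -
      have "k * dist (X m) (X n) \<le> g (X m) - g (X n)"
        using X_S[of m n] that by (simp add: S_def)
      also have "\<dots> < k * e" using decN[OF that(1)] L(2)[of n] N by linarith
      finally show ?thesis using \<open>k > 0\<close> by simp
    qed
    then show "\<exists>M. \<forall>m\<ge>M. \<forall>n>m. dist (X m) (X n) < e" by blast
  qed
  then obtain x where lim: "X \<longlonglongrightarrow> x"
    using Cauchy_convergent convergent_def by blast
  have x_le: "x \<in> D \<and> g x \<le> a" if "eventually (\<lambda>m. g (X m) \<le> a) sequentially" for a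
    using Lim_in_closed_set[OF closed _ _ lim, of a] that X(2) by simp
  have x_S: "x \<in> S (X n)" for n
  proof -
    have "x \<in> D \<and> g x \<le> g (X n) - k * dist (X n) x + e" if "e > 0" for e
    proof (rule x_le)
      have "(\<lambda>m. g (X n) - k * dist (X n) (X m)) \<longlonglongrightarrow> g (X n) - k * dist (X n) x"
        by (intro tendsto_intros lim)
      then have "eventually (\<lambda>m. g (X n) - k * dist (X n) (X m) < g (X n) - k * dist (X n) x + e) sequentially"
        using that by (intro order_tendstoD(2)) auto
      then show "eventually (\<lambda>m. g (X m) \<le> g (X n) - k * dist (X n) x + e) sequentially"
        using eventually_ge_at_top[of n]
        by eventually_elim (use X_S in \<open>fastforce simp: S_def\<close>)
    qed
    from this[OF zero_less_one] this show ?thesis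
      using field_le_epsilon[of "g x" "g (X n) - k * dist (X n) x"] by (auto simp: S_def)
  qed
  then have "x \<in> D" by (auto simp: S_def)
  have "g x = 0"
  proof (rule ccontr)
    assume "g x \<noteq> 0"
    then have "0 < g x" using nonneg[OF \<open>x \<in> D\<close>] by simp
    then obtain u where u: "u \<in> S x" "u \<noteq> x"
      using descent[OF \<open>x \<in> D\<close>] by (auto simp: S_def)
    have "0 < k * dist x u" using u(2) \<open>k > 0\<close> by simp
    then have "g u < g x" using u(1) by (simp add: S_def)
    have "L \<le> (L + g u) / 2"
    proof (rule LIMSEQ_le)
      show "(\<lambda>n. g (X (Suc n))) \<longlonglongrightarrow> L" using L(1) by (rule LIMSEQ_Suc)
      show "(\<lambda>n. (g (X n) + g u) / 2) \<longlonglongrightarrow> (L + g u) / 2" by (intro tendsto_intros L) auto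
      show "\<exists>N. \<forall>n\<ge>N. g (X (Suc n)) \<le> (g (X n) + g u) / 2"
        using half S_trans[OF x_S u(1)] by blast
    qed
    then have "L \<le> g u" by simp
    then have "L < g x" using \<open>g u < g x\<close> by simp
    then obtain c where c: "L < c" "c < g x" using dense by blast
    have "eventually (\<lambda>m. g (X m) \<le> c) sequentially"
      using order_tendstoD(2)[OF L(1) c(1)] by eventually_elim simp
    then show False using x_le c(2) by fastforce
  qed
  moreover have "k * dist x\<^sub>0 x \<le> g x\<^sub>0" using x_S[of 0] \<open>g x = 0\<close> by (simp add: X(1) S_def)
  ultimately show ?thesis using \<open>x \<in> D\<close> by blast
qed

section \<open>Excess over a closed convex cone\<close>

text \<open>
  Thickening a point outside a convex set by \<open>s\<close> increases its excess by the full amount \<open>s\<close>.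
  Moving from \<open>y\<close> straight away from a nearly closest point \<open>c\<close> of \<open>C\<close> achieves this, since
  \<open>infdist\<close> is convex along that ray, vanishes at \<open>c\<close>, and has slope nearly one between \<open>c\<close> and \<open>y\<close>.
\<close>

lemma infdist_add_le:
  fixes C :: "'a::real_normed_vector set"
  assumes "convex C" "closed C" "C \<noteq> {}" "y \<notin> C" "s \<ge> 0"
    and bound: "\<And>z. norm (z - y) \<le> s \<Longrightarrow> infdist z C \<le> M"
  shows "infdist y C + s \<le> M"
proof -
  define d where "d = infdist y C"
  have d: "d > 0"
    using in_closed_iff_infdist_zero[OF \<open>closed C\<close> \<open>C \<noteq> {}\<close>] infdist_nonneg[of y C] \<open>y \<notin> C\<close>
    by (fastforce simp: d_def)
  have step: "d * (\<rho> + s) \<le> M * \<rho>" if "c \<in> C" "\<rho> = dist y c" for c \<rho>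
  proof -
    have "d \<le> \<rho>" using that infdist_le by (auto simp: d_def)
    then have \<rho>: "\<rho> > 0" using d by simp
    define z where "z = y + (s / \<rho>) *\<^sub>R (y - c)"
    define t where "t = \<rho> / (\<rho> + s)"
    have t: "0 < t" "t \<le> 1" "1 - t = s / (\<rho> + s)"
      using \<open>\<rho> > 0\<close> \<open>s \<ge> 0\<close> by (auto simp: t_def field_simps)
    have "norm (z - y) \<le> s" using \<open>\<rho> > 0\<close> \<open>s \<ge> 0\<close> that by (simp add: z_def dist_norm)
    then have "infdist z C \<le> M" by (rule bound)
    have "t * (s / \<rho>) = 1 - t"
      using \<rho> by (simp add: t(3)) (simp add: t_def)
    then have y: "t *\<^sub>R z + (1 - t) *\<^sub>R c = y"
      unfolding z_def by (simp add: scaleR_right_distrib scaleR_right_diff_distrib scaleR_left_diff_distrib)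
    have "d / t \<le> infdist z C"
      unfolding infdist_notempty[OF \<open>C \<noteq> {}\<close>]
    proof (rule cINF_greatest[OF \<open>C \<noteq> {}\<close>])
      fix c' assume "c' \<in> C"
      then have "t *\<^sub>R c' + (1 - t) *\<^sub>R c \<in> C"
        using \<open>convex C\<close> \<open>c \<in> C\<close> t by (intro convexD) auto
      then have "d \<le> dist y (t *\<^sub>R c' + (1 - t) *\<^sub>R c)" by (simp add: d_def infdist_le)
      also have "\<dots> = t * dist z c'"
        using t(1) by (subst y[symmetric]) (simp add: dist_norm flip: scaleR_right_diff_distrib)
      finally show "d / t \<le> dist z c'" using t(1) by (simp add: pos_divide_le_eq mult.commute)
    qed
    then have "d / t \<le> M" using \<open>infdist z C \<le> M\<close> by simp
    then show ?thesis using \<rho> \<open>s \<ge> 0\<close> by (simp add: t_def field_simps)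
  qed
  have "infdist y C \<le> M" using bound[of y] \<open>s \<ge> 0\<close> by simp
  then have M: "0 < M" using d by (simp add: d_def)
  \<comment> \<open>Let the distance of \<open>c\<close> to \<open>y\<close> tend to \<open>d\<close>; the slack \<open>e / M\<close> becomes \<open>e\<close> after scaling.\<close>
  have "d * (d + s) \<le> M * d"
  proof (rule field_le_epsilon)
    fix e :: real assume "e > 0"
    then have "infdist y C < d + e / M" using M by (simp add: d_def)
    then obtain c where c: "c \<in> C" "dist y c < d + e / M"
      using \<open>C \<noteq> {}\<close> by (auto simp: infdist_notempty cInf_less_iff)
    have "d \<le> dist y c" using c(1) by (simp add: d_def infdist_le)
    then have "d * (d + s) \<le> d * (dist y c + s)" using d by simp
    also have "\<dots> \<le> M * dist y c" using step[OF c(1) refl] .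
    also have "\<dots> \<le> M * (d + e / M)" using c(2) M by simp
    also have "\<dots> = M * d + e" using M by (simp add: distrib_left)
    finally show "d * (d + s) \<le> M * d + e" .
  qed
  then show ?thesis using d by (simp add: d_def mult.commute)
qed

lemma point_dist_eq_infdist:
  assumes "S \<noteq> {}"
  shows "point_dist y S = ereal (infdist y S)"
proof -
  have "bdd_below ((\<lambda>s. dist y s) ` S)" by (rule bdd_belowI[of _ 0]) auto
  then show ?thesis
    using assms ereal_Inf'[of "(\<lambda>s. dist y s) ` S"]
    by (simp add: point_dist_def infdist_notempty dist_norm image_image)
qed

lemma mem_enlarge_iff: "S \<noteq> {} \<Longrightarrow> z \<in> enlarge S r \<longleftrightarrow> infdist z S \<le> r"
  by (simp add: enlarge_def point_dist_eq_infdist)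

lemma exc_le_iff: "C \<noteq> {} \<Longrightarrow> exc A C \<le> e \<longleftrightarrow> (\<forall>a\<in>A. ereal (infdist a C) \<le> e)"
  by (simp add: exc_def SUP_le_iff point_dist_eq_infdist)

lemma exc_nonneg:
  assumes "A \<noteq> {}"
  shows "0 \<le> exc A C"
proof -
  obtain a where "a \<in> A" using assms by blast
  moreover have "0 \<le> point_dist a C" by (simp add: point_dist_def INF_greatest)
  ultimately show ?thesis unfolding exc_def by (rule SUP_upper2)
qed

lemma exc_le_0_iff:
  assumes "closed C" "C \<noteq> {}"
  shows "exc A C \<le> 0 \<longleftrightarrow> A \<subseteq> C"
proof -
  have "infdist a C \<le> 0 \<longleftrightarrow> a \<in> C" for a
    using in_closed_iff_infdist_zero[OF assms] infdist_nonneg[of a C] by (metis order_antisym order_refl)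
  then show ?thesis
    by (auto simp: exc_le_iff[OF assms(2)])
qed

text \<open>
  The excess inherits lower semicontinuity from the map: it exceeds \<open>a\<close> exactly when the
  value meets the open set of points at distance more than \<open>a\<close> from \<open>C\<close>.
\<close>

lemma closed_exc_sublevel:
  assumes "lower_semicontinuous_map G" "C \<noteq> {}"
  shows "closed {x. exc (G x) C \<le> ereal a}"
proof -
  have "open {x. \<not> exc (G x) C \<le> ereal a}"
  proof (subst open_subopen, intro ballI)
    fix x assume "x \<in> {x. \<not> exc (G x) C \<le> ereal a}"
    define V where "V = {y. a < infdist y C}"
    have "open V" unfolding V_def by (intro open_Collect_less continuous_intros)
    moreover have iff: "\<not> exc (G x) C \<le> ereal a \<longleftrightarrow> G x \<inter> V \<noteq> {}" for x
      by (auto simp: exc_le_iff[OF assms(2)] V_def not_le)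
    ultimately have "\<forall>\<^sub>F x' in nhds x. G x' \<inter> V \<noteq> {}"
      using assms(1) \<open>x \<in> _\<close> unfolding lower_semicontinuous_map_def by blast
    then show "\<exists>T. open T \<and> x \<in> T \<and> T \<subseteq> {x. \<not> exc (G x) C \<le> ereal a}"
      unfolding eventually_nhds iff by blast
  qed
  then show ?thesis by (simp add: closed_def Compl_eq)
qed

text \<open>
  Adding elements of a convex cone never increases the distance to it, so the summand \<open>C\<close> in
  \<open>A + C\<close> is invisible to the excess.
\<close>

lemma infdist_le_of_infdist_plus_cone:
  fixes C :: "'a::real_normed_vector set"
  assumes "convex_cone C" "A \<noteq> {}" and A: "\<And>a. a \<in> A \<Longrightarrow> infdist a C \<le> e"
    and z: "infdist z (A + C) \<le> r"
  shows "infdist z C \<le> e + r"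
proof (rule field_le_epsilon)
  fix \<epsilon> :: real assume "\<epsilon> > 0"
  have ne: "C \<noteq> {}" using assms(1) by (rule convex_cone_nonempty)
  then have "A + C \<noteq> {}" using \<open>A \<noteq> {}\<close> by (auto simp: set_plus_def)
  moreover have "infdist z (A + C) < r + \<epsilon>" using z \<open>\<epsilon> > 0\<close> by simp
  ultimately obtain w where "w \<in> A + C" and w: "dist z w < r + \<epsilon>"
    by (auto simp: infdist_notempty cInf_less_iff)
  then obtain a c where ac: "a \<in> A" "c \<in> C" "w = a + c" by (auto elim: set_plus_elim)
  have "infdist (a + c) C \<le> infdist a C"
    unfolding infdist_notempty[OF ne, of a]
  proof (rule cINF_greatest[OF ne])
    fix c' assume "c' \<in> C"
    then have "c' + c \<in> C" using convex_cone_add[OF assms(1)] ac(2) by blast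
    then have "infdist (a + c) C \<le> dist (a + c) (c' + c)" by (rule infdist_le)
    then show "infdist (a + c) C \<le> dist a c'" by simp
  qed
  then have "infdist w C \<le> e" using A[OF ac(1)] ac(3) by simp
  then show "infdist z C \<le> e + r + \<epsilon>" using infdist_triangle[of z C w] w by simp
qed

text \<open>
  Outside \<open>C\<close>, the enlargement by \<open>\<alpha> * r\<close> adds that amount to the excess of \<open>A\<close>, while the
  inclusion caps the result at \<open>e + r\<close>.  The condition \<open>(\<alpha> - 1) * r \<le> e\<close> takes care of points of
  \<open>A\<close> that have already entered \<open>C\<close>, whose excess cannot decrease any further.
\<close>

lemma exc_descent:
  fixes C :: "'a::real_normed_vector set"
  assumes C: "closed C" "convex_cone C" and "A \<noteq> {}"
    and B: "exc B C \<le> ereal e" "B \<noteq> {}"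
    and incl: "enlarge A (\<alpha> * r) \<subseteq> enlarge (B + C) r"
    and "\<alpha> \<ge> 0" "r \<ge> 0" "(\<alpha> - 1) * r \<le> e"
  shows "exc A C \<le> ereal (e - (\<alpha> - 1) * r)"
proof -
  have ne: "C \<noteq> {}" using C(2) by (rule convex_cone_nonempty)
  then have "B + C \<noteq> {}" using \<open>B \<noteq> {}\<close> by (auto simp: set_plus_def)
  have "infdist a C \<le> e - (\<alpha> - 1) * r" if "a \<in> A" for a
  proof (cases "a \<in> C")
    case True
    then show ?thesis using assms by simp
  next
    case False
    have "infdist a C + \<alpha> * r \<le> e + r"
    proof (rule infdist_add_le[OF _ C(1) ne False])
      show "convex C" using C(2) by (simp add: convex_cone_def)
      fix z assume "norm (z - a) \<le> \<alpha> * r"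
      then have "infdist z A \<le> \<alpha> * r" using that by (intro infdist_le2) (auto simp: dist_norm)
      then have "infdist z (B + C) \<le> r"
        using incl mem_enlarge_iff[OF \<open>A \<noteq> {}\<close>] mem_enlarge_iff[OF \<open>B + C \<noteq> {}\<close>] by blast
      then show "infdist z C \<le> e + r"
        using B by (intro infdist_le_of_infdist_plus_cone[OF C(2)]) (auto simp: exc_le_iff[OF ne])
    qed (use assms in auto)
    then show ?thesis by (simp add: algebra_simps)
  qed
  then show ?thesis by (simp add: exc_le_iff[OF ne])
qed

text \<open>
  Descent is applied to the excess on the sublevel set of the starting point, where the
  excess is finite.
\<close>

lemma error_bound:
  fixes G :: "'x::banach \<Rightarrow> 'y::real_normed_vector set"
  assumes C: "closed C" "convex_cone C"
    and lsc: "lower_semicontinuous_map G" and ne: "\<And>x. G x \<noteq> {}"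
    and "\<alpha> > 1" and inc: "\<And>x. \<not> G x \<subseteq> C \<Longrightarrow> ereal \<alpha> < inc_rate C G x"
    and start: "exc (G x\<^sub>0) C \<le> ereal e"
  shows "\<exists>x. G x \<subseteq> C \<and> (\<alpha> - 1) * dist x\<^sub>0 x \<le> e"
proof -
  have "C \<noteq> {}" using C(2) by (rule convex_cone_nonempty)
  define D where "D = {x. exc (G x) C \<le> ereal e}"
  define g where "g x = real_of_ereal (exc (G x) C)" for x
  have g: "exc (G x) C = ereal (g x)" if "x \<in> D" for x
    using that exc_nonneg[OF ne, of x C] unfolding D_def g_def
    by (cases "exc (G x) C") auto
  have "\<exists>x\<in>D. g x = 0 \<and> (\<alpha> - 1) * dist x\<^sub>0 x \<le> g x\<^sub>0"
  proof (rule descent_imp_zero)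
    show "closed {x \<in> D. g x \<le> a}" for a
    proof -
      have "{x \<in> D. g x \<le> a} = {x. exc (G x) C \<le> ereal e} \<inter> {x. exc (G x) C \<le> ereal a}"
        using g by (force simp: D_def)
      then show ?thesis using closed_exc_sublevel[OF lsc \<open>C \<noteq> {}\<close>] by auto
    qed
    show "0 \<le> g x" for x
      using exc_nonneg[OF ne] by (simp add: g_def real_of_ereal_pos)
    show "0 < \<alpha> - 1" using \<open>\<alpha> > 1\<close> by simp
    show "x\<^sub>0 \<in> D" using start by (simp add: D_def)
    fix x assume x: "x \<in> D" "0 < g x"
    then have "\<not> G x \<subseteq> C" using exc_le_0_iff[OF C(1) \<open>C \<noteq> {}\<close>, of "G x"] g[OF x(1)] by simp
    then have "ereal \<alpha> < inc_rate C G x" by (rule inc)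
    then obtain \<alpha>' \<delta> where \<alpha>': "\<alpha> < \<alpha>'" and "\<delta> > 0"
      and \<delta>: "\<forall>r\<in>{0<..\<delta>}. \<exists>u\<in>cball x r. enlarge (G u) (\<alpha>' * r) \<subseteq> enlarge (G x + C) r"
      unfolding inc_rate_def less_Sup_iff by (auto simp del: mem_cball)
    \<comment> \<open>The second bound keeps the step from overshooting the zero.\<close>
    define r where "r = min \<delta> (g x / (\<alpha>' - 1))"
    have "1 < \<alpha>'" using \<alpha>' \<open>\<alpha> > 1\<close> by simp
    then have r: "0 < r" "r \<le> \<delta>" using \<open>\<delta> > 0\<close> x(2) by (auto simp: r_def)
    have "r \<le> g x / (\<alpha>' - 1)" by (simp add: r_def)
    then have overshoot: "(\<alpha>' - 1) * r \<le> g x"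
      using \<open>1 < \<alpha>'\<close> by (simp add: pos_le_divide_eq mult.commute)
    obtain u where u: "dist x u \<le> r" and incl: "enlarge (G u) (\<alpha>' * r) \<subseteq> enlarge (G x + C) r"
      using \<delta> r by (meson greaterThanAtMost_iff mem_cball)
    have exc_u: "exc (G u) C \<le> ereal (g x - (\<alpha>' - 1) * r)"
      using r overshoot \<open>1 < \<alpha>'\<close> g[OF x(1)] by (intro exc_descent[OF C ne _ ne incl]) auto
    have pos: "0 < (\<alpha>' - 1) * r" using r(1) \<open>1 < \<alpha>'\<close> by simp
    have "exc (G u) C \<le> exc (G x) C"
      by (rule order_trans[OF exc_u]) (use pos g[OF x(1)] in simp)
    then have "u \<in> D" using x(1) order_trans unfolding D_def by blast
    then have gu: "g u \<le> g x - (\<alpha>' - 1) * r" using exc_u g by simp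
    have "(\<alpha> - 1) * dist x u \<le> (\<alpha>' - 1) * r"
      using u \<alpha>' \<open>\<alpha> > 1\<close> by (intro mult_mono) auto
    then show "\<exists>u\<in>D. u \<noteq> x \<and> g u + (\<alpha> - 1) * dist x u \<le> g x"
      using \<open>u \<in> D\<close> gu pos by (intro bexI[of _ u]) auto
  qed
  then obtain x where "x \<in> D" "g x = 0" "(\<alpha> - 1) * dist x\<^sub>0 x \<le> g x\<^sub>0" by blast
  moreover have "g x\<^sub>0 \<le> e" using g[of x\<^sub>0] start by (simp add: D_def)
  moreover have "G x \<subseteq> C"
    using exc_le_0_iff[OF C(1) \<open>C \<noteq> {}\<close>, of "G x"] g[OF \<open>x \<in> D\<close>] \<open>g x = 0\<close> by simp
  ultimately show ?thesis using order_trans by blast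
qed

section \<open>The optimal value function\<close>

lemma feasible_convex_comb:
  assumes "C_concave C F" "convex_cone C" "F z\<^sub>1 \<subseteq> C" "F z\<^sub>2 \<subseteq> C" "0 \<le> t" "t \<le> 1"
  shows "F (t *\<^sub>R z\<^sub>1 + (1 - t) *\<^sub>R z\<^sub>2) \<subseteq> C"
proof
  fix y assume "y \<in> F (t *\<^sub>R z\<^sub>1 + (1 - t) *\<^sub>R z\<^sub>2)"
  then have "y \<in> (\<lambda>y. t *\<^sub>R y) ` F z\<^sub>1 + (\<lambda>y. (1 - t) *\<^sub>R y) ` F z\<^sub>2 + C"
    using assms(1,5,6) unfolding C_concave_def by (meson atLeastAtMost_iff subsetD)
  then obtain y1 y2 c where "y = t *\<^sub>R y1 + (1 - t) *\<^sub>R y2 + c" "y1 \<in> F z\<^sub>1" "y2 \<in> F z\<^sub>2" "c \<in> C"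
    by (auto elim!: set_plus_elim)
  then show "y \<in> C"
    using assms(3-6) by (auto intro!: convex_cone_add[OF assms(2)] convex_cone_scaleR[OF assms(2)])
qed

lemma opt_val_le:
  assumes "dom_val \<phi> F C = UNIV" "F (p, x) \<subseteq> C"
  shows "real_of_ereal (opt_val \<phi> F C p) \<le> \<phi> (p, x)"
proof -
  have "p \<in> dom_val \<phi> F C" using assms(1) by simp
  moreover have "opt_val \<phi> F C p \<le> ereal (\<phi> (p, x))"
    unfolding opt_val_def using assms(2) by (intro INF_lower) (simp add: feasible_def)
  ultimately show ?thesis
    by (cases "opt_val \<phi> F C p") (auto simp: dom_val_def)
qed

lemma near_optimal:
  assumes "dom_val \<phi> F C = UNIV" "e > 0"
  obtains x where "F (p, x) \<subseteq> C" "\<phi> (p, x) < real_of_ereal (opt_val \<phi> F C p) + e"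
proof -
  have "p \<in> dom_val \<phi> F C" using assms(1) by simp
  then have "opt_val \<phi> F C p < ereal (real_of_ereal (opt_val \<phi> F C p) + e)"
    using assms(2) by (cases "opt_val \<phi> F C p") (auto simp: dom_val_def)
  then show thesis
    using that unfolding opt_val_def INF_less_iff by (auto simp: feasible_def)
qed

lemma convex_opt_val:
  assumes dom: "dom_val \<phi> F C = UNIV" and conv: "convex_on UNIV \<phi>"
    and F: "C_concave C F" "convex_cone C"
  shows "convex_on UNIV (\<lambda>p. real_of_ereal (opt_val \<phi> F C p))" (is "convex_on UNIV ?v")
proof (rule convex_onI)
  fix t :: real and p q assume t: "0 < t" "t < 1"
  show "?v ((1 - t) *\<^sub>R p + t *\<^sub>R q) \<le> (1 - t) * ?v p + t * ?v q"
  proof (rule field_le_epsilon)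
    fix e :: real assume "e > 0"
    obtain x where x: "F (p, x) \<subseteq> C" "\<phi> (p, x) < ?v p + e" using near_optimal[OF dom \<open>e > 0\<close>] .
    obtain y where y: "F (q, y) \<subseteq> C" "\<phi> (q, y) < ?v q + e" using near_optimal[OF dom \<open>e > 0\<close>] .
    have "F ((1 - t) *\<^sub>R (p, x) + t *\<^sub>R (q, y)) \<subseteq> C"
      using feasible_convex_comb[OF F x(1) y(1), of "1 - t"] t by simp
    then have "?v ((1 - t) *\<^sub>R p + t *\<^sub>R q) \<le> \<phi> ((1 - t) *\<^sub>R (p, x) + t *\<^sub>R (q, y))"
      using opt_val_le[OF dom, of "(1 - t) *\<^sub>R p + t *\<^sub>R q" "(1 - t) *\<^sub>R x + t *\<^sub>R y"] by simp
    also have "\<dots> \<le> (1 - t) * \<phi> (p, x) + t * \<phi> (q, y)"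
      using convex_onD[OF conv, of t "(p, x)" "(q, y)"] t by simp
    also have "\<dots> \<le> (1 - t) * (?v p + e) + t * (?v q + e)"
      using x(2) y(2) t by (intro add_mono mult_left_mono) auto
    finally show "?v ((1 - t) *\<^sub>R p + t *\<^sub>R q) \<le> (1 - t) * ?v p + t * ?v q + e"
      by (simp add: algebra_simps)
  qed
qed simp

lemma continuous_prod_near:
  fixes \<phi> :: "'p::real_normed_vector \<times> 'x::real_normed_vector \<Rightarrow> real"
  assumes "continuous_on UNIV \<phi>"
  obtains \<delta> where "\<delta> > 0"
    "\<And>p x. dist pbar p \<le> \<delta> \<Longrightarrow> dist xbar x \<le> \<delta> \<Longrightarrow> \<bar>\<phi> (p, x) - \<phi> (pbar, xbar)\<bar> \<le> 1"
proof -
  obtain d where d: "d > 0" "\<And>z. dist z (pbar, xbar) < d \<Longrightarrow> dist (\<phi> z) (\<phi> (pbar, xbar)) < 1"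
    using assms unfolding continuous_on_iff by (metis UNIV_I zero_less_one)
  have "\<bar>\<phi> (p, x) - \<phi> (pbar, xbar)\<bar> \<le> 1" if "dist pbar p \<le> d / 3" "dist xbar x \<le> d / 3" for p x
  proof -
    have "dist (p, x) (pbar, xbar) \<le> dist p pbar + dist x xbar"
      unfolding dist_Pair_Pair by (rule sqrt_sum_squares_le_sum) auto
    then have "dist (p, x) (pbar, xbar) < d" using that d(1) by (simp add: dist_commute)
    from d(2)[OF this] show ?thesis by (simp add: dist_real_def)
  qed
  then show thesis using that[of "d / 3"] d(1) by simp
qed

text \<open>
  The optimal value cannot fall faster than linearly away from \<open>pbar\<close>.  It is convex,
  so an upper bound on a ball around \<open>pbar\<close> is enough, and this bound comes from feasible points of
  the perturbed problems that stay close to a fixed feasible point of the problem at \<open>pbar\<close>.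
\<close>

lemma opt_val_calm_below:
  fixes F :: "'p::real_normed_vector \<times> 'x::banach \<Rightarrow> 'y::real_normed_vector set"
  assumes C: "closed C" "convex_cone C" and ne: "\<And>p x. F (p, x) \<noteq> {}"
    and q: "qcsvi \<phi> F C" and dom: "dom_val \<phi> F C = UNIV"
  obtains \<kappa> where "\<kappa> \<ge> 0"
    "\<And>p. real_of_ereal (opt_val \<phi> F C pbar) - \<kappa> * norm (p - pbar) \<le> real_of_ereal (opt_val \<phi> F C p)"
proof -
  let ?v = "\<lambda>p. real_of_ereal (opt_val \<phi> F C p)"
  have conv: "convex_on UNIV \<phi>" and cont: "continuous_on UNIV \<phi>"
    and lsc: "\<And>p. lower_semicontinuous_map (\<lambda>x. F (p, x))"
    and conc: "C_concave C F" and usc: "\<And>x. hausdorff_C_usc C (\<lambda>p. F (p, x))"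
    and inc: "alpha_F C F > 1"
    using q by (auto simp: qcsvi_def)
  obtain x0 where x0: "F (pbar, x0) \<subseteq> C" using near_optimal[OF dom zero_less_one] .
  have "C \<noteq> {}" using C(2) by (rule convex_cone_nonempty)
  then have neC: "F (pbar, x0) + C \<noteq> {}" using ne[of pbar x0] by (auto simp: set_plus_def)
  obtain \<delta> where "\<delta> > 0" and \<delta>:
    "\<And>p x. dist pbar p \<le> \<delta> \<Longrightarrow> dist x0 x \<le> \<delta> \<Longrightarrow> \<bar>\<phi> (p, x) - \<phi> (pbar, x0)\<bar> \<le> 1"
    using continuous_prod_near[OF cont] by blast
  obtain \<alpha> where \<alpha>: "1 < \<alpha>" "ereal \<alpha> < alpha_F C F"
    using ereal_dense2[OF inc] by (auto simp: one_ereal_def)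
  have inc: "ereal \<alpha> < inc_rate C (\<lambda>x'. F (p, x')) x" if "\<not> F (p, x) \<subseteq> C" for p x
    using \<alpha>(2) that unfolding alpha_F_def by (elim order_less_le_trans) (auto intro: Inf_lower)
  \<comment> \<open>An excess of at most \<open>\<epsilon>\<close> is repaired by a move of length at most \<open>\<delta>\<close>.\<close>
  define \<epsilon> where "\<epsilon> = (\<alpha> - 1) * \<delta>"
  have "\<epsilon> > 0" using \<alpha> \<open>\<delta> > 0\<close> by (simp add: \<epsilon>_def)
  then obtain \<eta> where "\<eta> > 0" and \<eta>: "\<And>p. p \<in> cball pbar \<eta> \<Longrightarrow> F (p, x0) \<subseteq> enlarge (F (pbar, x0) + C) \<epsilon>"
    using usc unfolding hausdorff_C_usc_def by meson
  define \<rho> where "\<rho> = min \<eta> \<delta>"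
  have "\<rho> > 0" using \<open>\<eta> > 0\<close> \<open>\<delta> > 0\<close> by (simp add: \<rho>_def)
  define M where "M = \<phi> (pbar, x0) + 1"
  have M: "?v p \<le> M" if "p \<in> cball pbar \<rho>" for p
  proof -
    have "infdist y C \<le> 0 + \<epsilon>" if "y \<in> F (p, x0)" for y
    proof (rule infdist_le_of_infdist_plus_cone[OF C(2) ne])
      show "infdist a C \<le> 0" if "a \<in> F (pbar, x0)" for a using x0 that by auto
      show "infdist y (F (pbar, x0) + C) \<le> \<epsilon>"
        using \<eta>[of p] \<open>p \<in> cball pbar \<rho>\<close> that mem_enlarge_iff[OF neC] by (auto simp: \<rho>_def)
    qed
    then have "exc (F (p, x0)) C \<le> ereal \<epsilon>" by (simp add: exc_le_iff[OF \<open>C \<noteq> {}\<close>])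
    then obtain x where x: "F (p, x) \<subseteq> C" "(\<alpha> - 1) * dist x0 x \<le> \<epsilon>"
      using error_bound[OF C lsc ne \<alpha>(1) inc] by blast
    then have "dist x0 x \<le> \<delta>" using \<alpha>(1) by (simp add: \<epsilon>_def)
    then have "\<phi> (p, x) \<le> M" using \<delta>[of p x] that by (simp add: M_def \<rho>_def abs_le_iff)
    then show ?thesis using opt_val_le[where F=F and x=x, OF dom x(1)] by simp
  qed
  have "?v pbar - (M - ?v pbar) / \<rho> * norm (p - pbar) \<le> ?v p" for p
    using convex_lower_bound[OF convex_opt_val[OF dom conv conc C(2)] \<open>\<rho> > 0\<close> M] .
  moreover have "(M - ?v pbar) / \<rho> \<ge> 0" using M[of pbar] \<open>\<rho> > 0\<close> by simp
  ultimately show thesis using that by blast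
qed

section \<open>Exactness of the penalty\<close>

theorem corollary4p6:
  fixes C :: "'y::banach set"
    and \<phi> :: "'p::banach \<times> 'x::banach \<Rightarrow> real"
    and F :: "'p \<times> 'x \<Rightarrow> 'y set"
  assumes "closed C" and "convex_cone C" and "{0} \<subset> C" and "C \<subset> UNIV"
    and "\<And>p x. F (p, x) \<noteq> {}" and "\<And>p x. closed (F (p, x))"
    and "qcsvi \<phi> F C"
    and "dom_val \<phi> F C = UNIV"
    and "\<And>pbar xbar. xbar \<in> Argmin \<phi> F C pbar \<Longrightarrow>
           \<exists>\<beta>>0. \<exists>r>0. \<forall>x\<in>cball xbar r.
             point_dist pbar {p. F (p, x) \<subseteq> C} \<le> ereal \<beta> * exc (F (pbar, x)) C"
  shows "\<forall>pbar. \<forall>xbar\<in>Argmin \<phi> F C pbar. admits_penalty_function \<phi> F C pbar xbar"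
proof (intro allI ballI)
  fix pbar xbar assume xbar: "xbar \<in> Argmin \<phi> F C pbar"
  let ?v = "\<lambda>p. real_of_ereal (opt_val \<phi> F C p)"
  let ?e = "\<lambda>x. exc (F (pbar, x)) C"
  have "C \<noteq> {}" using assms(3) by blast
  have conv: "convex_on UNIV \<phi>" and cont: "continuous_on UNIV \<phi>"
    using assms(7) by (auto simp: qcsvi_def)
  have feas: "F (pbar, xbar) \<subseteq> C" and "opt_val \<phi> F C pbar = ereal (\<phi> (pbar, xbar))"
    using xbar by (simp_all add: Argmin_def feasible_def)
  then have v: "?v pbar = \<phi> (pbar, xbar)" by simp
  obtain \<beta> r where "\<beta> > 0" "r > 0" and \<beta>: "\<And>x. x \<in> cball xbar r \<Longrightarrow>
      point_dist pbar {p. F (p, x) \<subseteq> C} \<le> ereal \<beta> * ?e x"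
    using assms(9)[OF xbar] by blast
  obtain \<kappa> where "\<kappa> \<ge> 0" and \<kappa>: "\<And>p. ?v pbar - \<kappa> * norm (p - pbar) \<le> ?v p"
    using opt_val_calm_below[OF assms(1,2,5,7,8)] by blast
  obtain \<delta>' where "\<delta>' > 0" and \<delta>': "\<And>p x. dist pbar p \<le> \<delta>' \<Longrightarrow> dist xbar x \<le> \<delta>' \<Longrightarrow>
      \<bar>\<phi> (p, x) - \<phi> (pbar, xbar)\<bar> \<le> 1"
    using continuous_prod_near[OF cont] by blast
  \<comment> \<open>Halving leaves room for the ball of radius \<open>\<delta>\<close> around a point \<open>p\<close> within \<open>\<delta>\<close> of \<open>pbar\<close>.\<close>
  define \<delta> where "\<delta> = \<delta>' / 2"
  have "\<delta> > 0" using \<open>\<delta>' > 0\<close> by (simp add: \<delta>_def)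
  \<comment> \<open>\<open>\<kappa>\<close> bounds the decrease of the optimal value, and \<open>2 / \<delta>\<close> the variation of \<open>\<phi>\<close> in the parameter,
    whose oscillation over the neighbourhood is at most 2.\<close>
  define K where "K = \<kappa> + 2 / \<delta>"
  have "K \<ge> 0" using \<open>\<kappa> \<ge> 0\<close> \<open>\<delta> > 0\<close> by (simp add: K_def)
  \<comment> \<open>If \<open>x\<close> is feasible for a nearby parameter, it can improve on \<open>xbar\<close> at \<open>pbar\<close> only slightly.\<close>
  have slice: "\<phi> (pbar, x) \<ge> \<phi> (pbar, xbar) - K * norm (p - pbar)"
    if x: "dist xbar x \<le> \<delta>" and p: "norm (p - pbar) \<le> \<delta>" "F (p, x) \<subseteq> C" for p x
  proof -
    have near: "\<bar>\<phi> (q, x) - \<phi> (pbar, xbar)\<bar> \<le> 1" if "dist p q \<le> \<delta>" for q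
    proof (rule \<delta>')
      show "dist pbar q \<le> \<delta>'"
        using dist_triangle[of pbar q p] p(1) that by (simp add: dist_norm norm_minus_commute \<delta>_def)
      show "dist xbar x \<le> \<delta>'" using x \<open>\<delta> > 0\<close> by (simp add: \<delta>_def)
    qed
    let ?M = "\<phi> (pbar, xbar) + 1"
    have "convex_on UNIV (\<lambda>q. \<phi> (q, x))"
    proof (rule convex_onI)
      fix t :: real and q1 q2 assume "0 < t" "t < 1"
      then show "\<phi> ((1 - t) *\<^sub>R q1 + t *\<^sub>R q2, x) \<le> (1 - t) * \<phi> (q1, x) + t * \<phi> (q2, x)"
        using convex_onD[OF conv, of t "(q1, x)" "(q2, x)"] by (simp flip: scaleR_left_distrib)
    qed simp
    moreover have "\<phi> (z, x) \<le> ?M" if "z \<in> cball p \<delta>" for z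
      using near[of z] that by simp
    ultimately have "\<phi> (p, x) - (?M - \<phi> (p, x)) / \<delta> * norm (pbar - p) \<le> \<phi> (pbar, x)"
      using \<open>\<delta> > 0\<close> by (intro convex_lower_bound)
    moreover have "(?M - \<phi> (p, x)) / \<delta> * norm (pbar - p) \<le> 2 / \<delta> * norm (pbar - p)"
      using near[of p] \<open>\<delta> > 0\<close> by (intro mult_right_mono divide_right_mono) auto
    moreover have "\<phi> (pbar, xbar) - \<kappa> * norm (p - pbar) \<le> \<phi> (p, x)"
      using \<kappa>[of p] opt_val_le[OF assms(8) p(2)] v by simp
    ultimately show ?thesis by (simp add: K_def distrib_right norm_minus_commute)
  qed
  have main: "ereal (\<phi> (pbar, xbar)) + ereal l * ?e xbar \<le> ereal (\<phi> (pbar, x)) + ereal l * ?e x"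
    if l: "l > 2 * \<beta> * K" and x: "dist xbar x \<le> min \<delta> r" for l x
  proof -
    have "l > 0" using l \<open>\<beta> > 0\<close> \<open>K \<ge> 0\<close> by (smt (verit) mult_nonneg_nonneg)
    have "?e xbar = 0"
      using exc_nonneg[OF assms(5)] exc_le_0_iff[OF assms(1) \<open>C \<noteq> {}\<close>] feas by (metis order_antisym)
    consider "?e x = \<infinity>" | "?e x = 0" | e where "?e x = ereal e" "e > 0"
      using exc_nonneg[OF assms(5), of pbar x C] by (cases "?e x") fastforce+
    then show ?thesis
    proof cases
      case 1
      then show ?thesis using \<open>l > 0\<close> by simp
    next
      case 2
      then have "F (pbar, x) \<subseteq> C" using exc_le_0_iff[OF assms(1) \<open>C \<noteq> {}\<close>] by (metis order_refl)
      then show ?thesis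
        using 2 \<open>?e xbar = 0\<close> opt_val_le[OF assms(8), of pbar x] v by simp
    next
      case 3
      have le: "2 * \<beta> * K * e \<le> l * e" using l \<open>e > 0\<close> by simp
      have "\<phi> (pbar, xbar) \<le> \<phi> (pbar, x) + l * e"
      proof (cases "2 * \<beta> * e \<le> \<delta>")
        case True
        have "point_dist pbar {p. F (p, x) \<subseteq> C} \<le> ereal (\<beta> * e)"
          using \<beta>[of x] x 3 by simp
        also have "\<dots> < ereal (2 * \<beta> * e)" using \<open>\<beta> > 0\<close> \<open>e > 0\<close> by simp
        finally obtain p where p: "F (p, x) \<subseteq> C" "norm (p - pbar) < 2 * \<beta> * e"
          unfolding point_dist_def INF_less_iff by (auto simp: norm_minus_commute)
        have "K * norm (p - pbar) \<le> K * (2 * \<beta> * e)"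
          using p(2) \<open>K \<ge> 0\<close> by (intro mult_left_mono) auto
        then show ?thesis using slice[of x p] p x True le by (simp add: mult_ac)
      next
        case False
        have "1 \<le> K * (2 * \<beta> * e)"
        proof -
          have "1 \<le> 2 / \<delta> * \<delta>" using \<open>\<delta> > 0\<close> by simp
          also have "\<dots> \<le> K * (2 * \<beta> * e)"
            using False \<open>\<kappa> \<ge> 0\<close> \<open>\<delta> > 0\<close> \<open>K \<ge> 0\<close> by (intro mult_mono) (auto simp: K_def)
          finally show ?thesis .
        qed
        moreover have "\<phi> (pbar, xbar) - 1 \<le> \<phi> (pbar, x)"
          using \<delta>'[of pbar x] x \<open>\<delta>' > 0\<close> by (simp add: \<delta>_def)
        ultimately show ?thesis using le by (simp add: mult_ac)
      qed
      then show ?thesis using 3 \<open>?e xbar = 0\<close> by simp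
    qed
  qed
  have "local_minimizer (\<lambda>x. ereal (\<phi> (pbar, x)) + ereal l * ?e x) xbar" if "l > 2 * \<beta> * K" for l
  proof -
    have "0 < min \<delta> r" using \<open>\<delta> > 0\<close> \<open>r > 0\<close> by simp
    then show ?thesis
      unfolding local_minimizer_def eventually_nhds_metric
      using main[OF that] by (fastforce simp: dist_commute)
  qed
  then show "admits_penalty_function \<phi> F C pbar xbar"
    unfolding admits_penalty_function_def using \<open>\<beta> > 0\<close> \<open>K \<ge> 0\<close>
    by (intro exI[of _ "2 * \<beta> * K"]) simp
qed

end
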